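(* Let $n,m\in\mathbb{N}_0$ with $n<m$, and let $\kappa\in\mathbb{R}$ with $|\kappa|>0$. Define $c_0=1$ and \[ c_j=\prod_{k=m+1-j}^{m}\frac{-i(n+k)}{n-k+1},\qquad j>0 , \] (only the values $c_j$ with $0\le j\le m-n-1$ are used). Then \[ I_2(n,m,\kappa,t)=t^{n+1}e^{i\kappa t}\sum_{j=n+2}^{m}\frac{c_{m-j}}{n-j+1}\left[J_{j,\kappa}(t)+iJ_{j-1,\kappa}(t)\right]+c_{m-n-1}\,I_2(n,n+1,\kappa,t). \]
   Context: $\mathbb{N}_0=\{0,1,2,\dots\}$ and $i$ is the imaginary unit. $J_m$ is the Bessel function of the first kind of integer order $m$, and $J_{m,\kappa}(t):=J_m(\kappa t)$ for real $t$. $I_2(n,m,\kappa,t):=\int t^nJ_{m,\kappa}(t)e^{i\kappa t}\,dt$ denotes the indefinite integral (an antiderivative in $t$ of $t^nJ_m(\kappa t)e^{i\kappa t}$); identities between indefinite integrals are understood up to an additive constant. Empty sums are $0$. *)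

theory Defs
  imports "HOL-Analysis.Analysis"
begin

text \<open>
  The Bessel function of the first kind of integer order, by its usual power series
  \<open>J\<^sub>m(z) = \<Sum>k. (-1)^k / (k! \<Gamma>(m + k + 1)) (z/2)^(m + 2k)\<close>.
  The entire function \<^const>\<open>rGamma\<close> is the reciprocal of Gamma, so for negative
  \<open>m\<close> the terms with \<open>m + k < 0\<close> vanish, as they should.
\<close>

definition bessel_J :: "int \<Rightarrow> complex \<Rightarrow> complex" where
  "bessel_J m z =
     (\<Sum>k::nat. (-1) ^ k / fact k * rGamma (of_int m + of_nat k + 1) * (z / 2) powi (m + 2 * int k))"

definition bessel_J_scaled :: "int \<Rightarrow> real \<Rightarrow> real \<Rightarrow> complex" where
  "bessel_J_scaled m \<kappa> t = bessel_J m (of_real (\<kappa> * t))"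

text \<open>The indefinite integral is rendered as the set of all antiderivatives on the real line.\<close>

definition I2 :: "nat \<Rightarrow> nat \<Rightarrow> real \<Rightarrow> (real \<Rightarrow> complex) set" where
  "I2 n m \<kappa> =
     {F. \<forall>t. (F has_vector_derivative
               of_real t ^ n * bessel_J_scaled (int m) \<kappa> t * exp (\<i> * of_real (\<kappa> * t))) (at t)}"

text \<open>
  For \<open>j = 0\<close> the product is empty, so the value is \<open>1\<close>.  The natural subtraction is harmless for
  \<open>j \<le> m + 1\<close>, and the denominators do not vanish for \<open>j < m - n\<close>, the only values used.
\<close>

definition c_coeff :: "nat \<Rightarrow> nat \<Rightarrow> nat \<Rightarrow> complex" where
  "c_coeff n m j =
     (\<Prod>k = m + 1 - j..m. - \<i> * (of_nat n + of_nat k) / (of_nat n - of_nat k + 1))"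

text \<open>Antiderivatives exist, so statements about all members of \<^const>\<open>I2\<close> are not vacuous.\<close>

lemma bessel_J_nat:
  "bessel_J (int m) z = (z / 2) ^ m * (\<Sum>k. ((-1) ^ k / (fact k * fact (m + k))) * ((z / 2)\<^sup>2) ^ k)"
  and summable_bessel_J_nat: "summable (\<lambda>k. ((-1) ^ k / (fact k * fact (m + k))) * (w::complex) ^ k)"
proof -
  show s: "summable (\<lambda>k. ((-1) ^ k / (fact k * fact (m + k))) * (w::complex) ^ k)" for w
  proof (rule summable_comparison_test)
    show "summable (\<lambda>k. norm w ^ k / fact k)"
      using summable_exp[of "norm w"] by (simp add: field_simps)
    have "norm (((-1) ^ k / (fact k * fact (m + k))) * w ^ k) \<le> norm w ^ k / fact k" for k
    proof -
      have "norm (((-1) ^ k / (fact k * fact (m + k))) * w ^ k)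
              = norm w ^ k / fact k * (1 / fact (m + k))"
        by (simp add: norm_mult norm_divide norm_power)
      also have "\<dots> \<le> norm w ^ k / fact k * 1"
        by (intro mult_left_mono) auto
      finally show ?thesis by simp
    qed
    then show "\<exists>N. \<forall>k\<ge>N. norm (((-1) ^ k / (fact k * fact (m + k))) * w ^ k) \<le> norm w ^ k / fact k"
      by blast
  qed
  have "rGamma (of_nat m + of_nat k + 1) = (1 / fact (m + k) :: complex)" for k
    using Gamma_fact[of "m + k", where 'a = complex]
    by (simp add: rGamma_inverse_Gamma divide_inverse add_ac)
  moreover have "(z / 2) powi (int m + 2 * int k) = (z / 2) ^ m * ((z / 2)\<^sup>2) ^ k" for k
  proof -
    have "(z / 2) powi (int m + 2 * int k) = (z / 2) powi (int (m + 2 * k))" by simp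
    then show ?thesis by (simp only: power_int_of_nat power_add power_mult)
  qed
  ultimately have "bessel_J (int m) z
      = (\<Sum>k. (z / 2) ^ m * (((-1) ^ k / (fact k * fact (m + k))) * ((z / 2)\<^sup>2) ^ k))"
    unfolding bessel_J_def by (intro suminf_cong) simp
  then show "bessel_J (int m) z
      = (z / 2) ^ m * (\<Sum>k. ((-1) ^ k / (fact k * fact (m + k))) * ((z / 2)\<^sup>2) ^ k)"
    by (simp only: suminf_mult[OF s])
qed

lemma isCont_bessel_J_nat: "isCont (bessel_J (int m)) z"
proof -
  let ?p = "\<lambda>w::complex. \<Sum>k. ((-1) ^ k / (fact k * fact (m + k))) * w ^ k"
  have "isCont ?p w" for w
    by (rule isCont_powser_converges_everywhere) (rule summable_bessel_J_nat)
  then have "isCont (\<lambda>z. ?p ((z / 2)\<^sup>2)) z"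
    by (intro isCont_o2[where g = ?p and f = "\<lambda>z. (z / 2)\<^sup>2"] continuous_intros) simp
  then have "isCont (\<lambda>z. (z / 2) ^ m * ?p ((z / 2)\<^sup>2)) z"
    by (intro continuous_mult continuous_power continuous_divide continuous_ident continuous_const) simp_all
  then show ?thesis by (simp only: bessel_J_nat[abs_def])
qed

lemma I2_nonempty: "I2 n m \<kappa> \<noteq> {}"
proof -
  let ?f = "\<lambda>t. of_real t ^ n * bessel_J_scaled (int m) \<kappa> t * exp (\<i> * of_real (\<kappa> * t))"
  have "isCont ?f t" for t
    unfolding bessel_J_scaled_def
    by (intro continuous_intros isCont_o2[where g = "bessel_J (int m)" and f = "\<lambda>t. of_real (\<kappa> * t)"]
        isCont_bessel_J_nat)
  then obtain F where "\<forall>t. (F has_vector_derivative ?f t) (at t)"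
    using einterval_antiderivative[of "-\<infinity>" "\<infinity>" ?f] by auto
  then show ?thesis by (auto simp: I2_def)
qed

end

theory Submission
  imports Defs
begin

text \<open>
  The proof is one integration by parts, iterated.  The two first-order relations
  \<open>z J\<^sub>p'(z) = p J\<^sub>p(z) - z J\<^sub>p\<^sub>+\<^sub>1(z)\<close> and
  \<open>z J\<^sub>p\<^sub>+\<^sub>1'(z) = z J\<^sub>p(z) - (p + 1) J\<^sub>p\<^sub>+\<^sub>1(z)\<close> give
  \<open>(t^(n+1) e^(i \<kappa> t) (J\<^sub>p\<^sub>+\<^sub>1 + i J\<^sub>p))' = t^n e^(i \<kappa> t) ((n - p) J\<^sub>p\<^sub>+\<^sub>1 + i (n + p + 1) J\<^sub>p)\<close>,
  all Bessel functions being taken at \<open>\<kappa> t\<close>: the combination \<open>J\<^sub>p\<^sub>+\<^sub>1 + i J\<^sub>p\<close> is the one for which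
  the terms carrying the extra factor \<open>\<kappa> t\<close> cancel (\<open>bessel_exp_by_parts\<close>).
  For \<open>p > n\<close>, dividing by \<open>n - p\<close> expresses the integrand of order \<open>p + 1\<close> by an exact derivative and
  a multiple of the integrand of order \<open>p\<close>.  The coefficients \<open>c\<^sub>j\<close> are the products
  of these multiples (\<open>c_coeff_descend\<close>), so the derivative of the finite sum in the theorem
  telescopes to the integrand of order \<open>m\<close> minus \<open>c\<^sub>m\<^sub>-\<^sub>n\<^sub>-\<^sub>1\<close> times the integrand of
  order \<open>n + 1\<close>.  The two sides of the identity then have the same derivative on the real line.

  For the Bessel relations, write \<open>J\<^sub>m(z) = (z/2)^m S\<^sub>m((z/2)^2)\<close> with \<open>S\<^sub>m\<close> entire; both
  follow from \<open>S\<^sub>m' = - S\<^sub>m\<^sub>+\<^sub>1\<close> and a coefficient comparison.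
\<close>

definition bessel_series :: "nat \<Rightarrow> complex \<Rightarrow> complex" where
  "bessel_series m w = (\<Sum>k. ((-1) ^ k / (fact k * fact (m + k))) * w ^ k)"

lemma bessel_J_eq_series: "bessel_J (int m) z = (z / 2) ^ m * bessel_series m ((z / 2)\<^sup>2)"
  by (simp add: bessel_J_nat bessel_series_def)

lemma bessel_series_has_derivative:
  "(bessel_series m has_field_derivative - bessel_series (Suc m) w) (at w)"
proof -
  let ?a = "\<lambda>k. (-1) ^ k / (fact k * fact (m + k)) :: complex"
  have "((\<lambda>w. \<Sum>k. ?a k * w ^ k) has_field_derivative (\<Sum>k. diffs ?a k * w ^ k)) (at w)"
    by (rule termdiffs_strong_converges_everywhere) (rule summable_bessel_J_nat)
  moreover have "diffs ?a k = - ((-1) ^ k / (fact k * fact (Suc m + k)))" for k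
  proof -
    have "of_nat (Suc k) * (- 1 * x / (of_nat (Suc k) * f * g)) = - (x / (f * g))"
      for x f g :: complex
      using of_nat_neq_0[of k, where 'a = complex] by simp
    then show ?thesis
      by (simp add: diffs_def del: of_nat_Suc)
  qed
  moreover have "(\<Sum>k. - ((-1) ^ k / (fact k * fact (Suc m + k))) * w ^ k) = - bessel_series (Suc m) w"
    using suminf_minus[OF summable_bessel_J_nat[of "Suc m" w]] by (simp add: bessel_series_def)
  ultimately show ?thesis
    by (simp add: bessel_series_def[abs_def])
qed

text \<open>
  This is the three-term recurrence of the Bessel functions, freed of powers of \<open>z\<close>.  It
  holds term by term: the terms of degree \<open>k\<close> in \<open>S\<^sub>m\<close> and in \<open>w S\<^sub>m\<^sub>+\<^sub>2\<close> are \<open>m + k + 1\<close> and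
  \<open>- k\<close> times the one in \<open>S\<^sub>m\<^sub>+\<^sub>1\<close>.
\<close>

lemma bessel_series_recurrence:
  "bessel_series m w + w * bessel_series (Suc (Suc m)) w = of_nat (Suc m) * bessel_series (Suc m) w"
proof -
  let ?a = "\<lambda>m k. ((-1) ^ k / (fact k * fact (m + k))) * w ^ k :: complex"
  have s: "?a m sums bessel_series m w" for m
    unfolding bessel_series_def by (rule summable_sums[OF summable_bessel_J_nat])
  \<comment> \<open>Prepending a zero term shifts the series of \<open>w S\<^sub>m\<^sub>+\<^sub>2\<close> by one.\<close>
  have "(\<lambda>k. w * ?a (Suc (Suc m)) k) sums (w * bessel_series (Suc (Suc m)) w)"
    by (rule sums_mult[OF s])
  moreover have "w * ?a (Suc (Suc m)) k = - of_nat (Suc k) * ?a (Suc m) (Suc k)" for k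
  proof -
    have "w * (x / (f * g) * y) = - c * (- 1 * x / (c * f * g) * (w * y))" if "c \<noteq> 0"
      for c x f g y :: complex
      using that by simp
    from this[OF of_nat_neq_0] show ?thesis
      by (simp del: of_nat_Suc)
  qed
  ultimately have "(\<lambda>k. - of_nat (Suc k) * ?a (Suc m) (Suc k)) sums (w * bessel_series (Suc (Suc m)) w)"
    by simp
  then have "(\<lambda>k. - of_nat k * ?a (Suc m) k) sums (w * bessel_series (Suc (Suc m)) w)"
    by (subst (asm) sums_Suc_iff[where f = "\<lambda>k. - of_nat k * ?a (Suc m) k"]) simp
  then have "(\<lambda>k. ?a m k + - of_nat k * ?a (Suc m) k)
      sums (bessel_series m w + w * bessel_series (Suc (Suc m)) w)"
    by (intro sums_add s)
  moreover have "?a m k + - of_nat k * ?a (Suc m) k = of_nat (Suc m) * ?a (Suc m) k" for k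
  proof -
    have "x / (f * g) * y + - of_nat k * (x / (f * (of_nat (Suc (m + k)) * g)) * y)
        = of_nat (Suc m) * (x / (f * (of_nat (Suc (m + k)) * g)) * y)"
      if "f \<noteq> 0" "g \<noteq> 0" for x f g y :: complex
    proof -
      define q where "q = x / (f * (of_nat (Suc (m + k)) * g)) * y"
      have "x / (f * g) * y = of_nat (Suc (m + k)) * q"
        unfolding q_def using of_nat_neq_0[of "m + k", where 'a = complex] that by simp
      moreover have "of_nat (Suc (m + k)) = of_nat (Suc m) + (of_nat k :: complex)"
        by simp
      ultimately show ?thesis
        unfolding q_def[symmetric] by (simp only: distrib_right) simp
    qed
    from this[of "fact k" "fact (m + k)" "(-1) ^ k" "w ^ k"] show ?thesis
      by (simp del: of_nat_Suc)
  qed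
  ultimately have "(\<lambda>k. of_nat (Suc m) * ?a (Suc m) k)
      sums (bessel_series m w + w * bessel_series (Suc (Suc m)) w)"
    by simp
  moreover have "(\<lambda>k. of_nat (Suc m) * ?a (Suc m) k) sums (of_nat (Suc m) * bessel_series (Suc m) w)"
    by (rule sums_mult[OF s])
  ultimately show ?thesis
    by (rule sums_unique2)
qed

lemma bessel_J_recurrence:
  "z * bessel_J (int p) z + z * bessel_J (int (Suc (Suc p))) z
    = 2 * of_nat (Suc p) * bessel_J (int (Suc p)) z"
proof -
  obtain u where z: "z = 2 * u"
    using that[of "z / 2"] by simp
  have "z * bessel_J (int p) z + z * bessel_J (int (Suc (Suc p))) z
      = 2 * u ^ Suc p * (bessel_series p (u\<^sup>2) + u\<^sup>2 * bessel_series (Suc (Suc p)) (u\<^sup>2))"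
    unfolding bessel_J_eq_series by (simp add: z algebra_simps power2_eq_square)
  also have "\<dots> = 2 * of_nat (Suc p) * bessel_J (int (Suc p)) z"
    unfolding bessel_series_recurrence bessel_J_eq_series by (simp add: z)
  finally show ?thesis .
qed

text \<open>
  The relations for \<open>J\<^sub>p'\<close> are stated after multiplication by \<open>z\<close>, so that they hold at
  \<open>z = 0\<close> too; the factor \<open>t^(n+1)\<close> of the application supplies this \<open>z\<close>.
\<close>

lemma bessel_J_has_deriv:
  "(bessel_J (int p) has_field_derivative deriv (bessel_J (int p)) z) (at z)"
  and mult_deriv_bessel_J:
  "z * deriv (bessel_J (int p)) z = of_nat p * bessel_J (int p) z - z * bessel_J (int (Suc p)) z"
proof -
  let ?D = "of_nat p * (z / 2) ^ (p - 1) / 2 * bessel_series p ((z / 2)\<^sup>2)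
    - (z / 2) ^ p * (z / 2) * bessel_series (Suc p) ((z / 2)\<^sup>2)"
  have "((\<lambda>z. (z / 2) ^ p * bessel_series p ((z / 2)\<^sup>2)) has_field_derivative ?D) (at z)"
    by (auto intro!: derivative_eq_intros DERIV_chain2[OF bessel_series_has_derivative])
  then have D: "(bessel_J (int p) has_field_derivative ?D) (at z)"
    by (simp only: bessel_J_eq_series[abs_def])
  then show "(bessel_J (int p) has_field_derivative deriv (bessel_J (int p)) z) (at z)"
    by (metis DERIV_imp_deriv)
  show "z * deriv (bessel_J (int p)) z = of_nat p * bessel_J (int p) z - z * bessel_J (int (Suc p)) z"
    unfolding DERIV_imp_deriv[OF D] bessel_J_eq_series
    by (cases p) (simp_all add: algebra_simps)
qed

lemma mult_deriv_bessel_J_Suc: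
  "z * deriv (bessel_J (int (Suc p))) z
    = z * bessel_J (int p) z - of_nat (Suc p) * bessel_J (int (Suc p)) z"
  using mult_deriv_bessel_J[of z "Suc p"] bessel_J_recurrence[of z p] by algebra

lemma bessel_J_scaled_has_vector_derivative:
  "(bessel_J_scaled (int p) \<kappa> has_vector_derivative
     of_real \<kappa> * deriv (bessel_J (int p)) (of_real (\<kappa> * t))) (at t)"
proof -
  have "((\<lambda>t. of_real (\<kappa> * t) :: complex) has_vector_derivative of_real \<kappa>) (at t)"
    by (auto intro!: derivative_eq_intros has_vector_derivative_of_real
        simp flip: has_real_derivative_iff_has_vector_derivative)
  from field_vector_diff_chain_at[OF this bessel_J_has_deriv]
  show ?thesis
    by (simp add: bessel_J_scaled_def[abs_def] o_def)
qed

definition I2_integrand :: "nat \<Rightarrow> real \<Rightarrow> real \<Rightarrow> nat \<Rightarrow> complex" where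
  "I2_integrand n \<kappa> t p =
     of_real t ^ n * bessel_J_scaled (int p) \<kappa> t * exp (\<i> * of_real (\<kappa> * t))"

lemma bessel_exp_by_parts:
  "((\<lambda>t. of_real t ^ (n + 1) * exp (\<i> * of_real (\<kappa> * t)) *
        (bessel_J_scaled (int (Suc p)) \<kappa> t + \<i> * bessel_J_scaled (int p) \<kappa> t))
    has_vector_derivative
      (of_nat n - of_nat p) * I2_integrand n \<kappa> t (Suc p)
      + \<i> * (of_nat n + of_nat (Suc p)) * I2_integrand n \<kappa> t p) (at t)"
proof -
  let ?e = "exp (\<i> * of_real (\<kappa> * t))"
  let ?J = "\<lambda>p. bessel_J_scaled (int p) \<kappa> t"
  define A where "A = deriv (bessel_J (int p)) (of_real (\<kappa> * t))"
  define B where "B = deriv (bessel_J (int (Suc p))) (of_real (\<kappa> * t))"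
  have A: "of_real t * (of_real \<kappa> * A) = of_nat p * ?J p - of_real (\<kappa> * t) * ?J (Suc p)"
    using mult_deriv_bessel_J[of "of_real (\<kappa> * t)" p]
    by (simp add: A_def bessel_J_scaled_def algebra_simps)
  have B: "of_real t * (of_real \<kappa> * B) = of_real (\<kappa> * t) * ?J p - of_nat (Suc p) * ?J (Suc p)"
    using mult_deriv_bessel_J_Suc[of "of_real (\<kappa> * t)" p]
    by (simp add: B_def bessel_J_scaled_def algebra_simps)
  have pow: "((\<lambda>t. of_real t ^ (n + 1) :: complex) has_vector_derivative
      of_nat (n + 1) * of_real t ^ n) (at t)"
    using has_vector_derivative_real_field[OF DERIV_power_Suc[OF DERIV_ident, of n "of_real t"]]
    by simp
  have "((\<lambda>z. exp (\<i> * (of_real \<kappa> * z))) has_field_derivative \<i> * of_real \<kappa> * ?e) (at (of_real t))"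
    by (auto intro!: derivative_eq_intros)
  from has_vector_derivative_real_field[OF this]
  have ex: "((\<lambda>t. exp (\<i> * of_real (\<kappa> * t))) has_vector_derivative \<i> * of_real \<kappa> * ?e) (at t)"
    by simp
  have "((\<lambda>t. bessel_J_scaled (int (Suc p)) \<kappa> t + \<i> * bessel_J_scaled (int p) \<kappa> t)
      has_vector_derivative of_real \<kappa> * B + \<i> * (of_real \<kappa> * A)) (at t)"
    unfolding A_def B_def
    by (intro has_vector_derivative_add has_vector_derivative_mult_right
        bessel_J_scaled_has_vector_derivative)
  from has_vector_derivative_mult[OF has_vector_derivative_mult[OF pow ex] this]
  have "((\<lambda>t. of_real t ^ (n + 1) * exp (\<i> * of_real (\<kappa> * t)) *
        (bessel_J_scaled (int (Suc p)) \<kappa> t + \<i> * bessel_J_scaled (int p) \<kappa> t))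
    has_vector_derivative
      of_real t ^ (n + 1) * ?e * (of_real \<kappa> * B + \<i> * (of_real \<kappa> * A))
      + (of_real t ^ (n + 1) * (\<i> * of_real \<kappa> * ?e) + of_nat (n + 1) * of_real t ^ n * ?e)
        * (?J (Suc p) + \<i> * ?J p)) (at t)" .
  moreover have "of_real t ^ (n + 1) * ?e * (of_real \<kappa> * B + \<i> * (of_real \<kappa> * A))
      + (of_real t ^ (n + 1) * (\<i> * of_real \<kappa> * ?e) + of_nat (n + 1) * of_real t ^ n * ?e)
        * (?J (Suc p) + \<i> * ?J p)
    = of_real t ^ n * ?e * ((of_real t * (of_real \<kappa> * B) + \<i> * (of_real t * (of_real \<kappa> * A)))
      + (\<i> * of_real (\<kappa> * t) + of_nat (n + 1)) * (?J (Suc p) + \<i> * ?J p))"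
    by (simp add: algebra_simps)
  moreover have "\<dots> = (of_nat n - of_nat p) * I2_integrand n \<kappa> t (Suc p)
      + \<i> * (of_nat n + of_nat (Suc p)) * I2_integrand n \<kappa> t p"
    unfolding A B by (simp add: I2_integrand_def algebra_simps)
  ultimately show ?thesis
    by simp
qed

lemma c_coeff_0: "c_coeff n m 0 = 1"
  by (simp add: c_coeff_def)

lemma c_coeff_descend:
  assumes "p < m"
  shows "c_coeff n m (m - p)
    = - \<i> * (of_nat n + of_nat (Suc p)) / (of_nat n - of_nat p) * c_coeff n m (m - Suc p)"
proof -
  have "m + 1 - (m - p) = Suc p" "m + 1 - (m - Suc p) = Suc (Suc p)"
    using assms by auto
  moreover have "{Suc p..m} = insert (Suc p) {Suc (Suc p)..m}"
    using assms by auto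
  ultimately show ?thesis
    by (simp add: c_coeff_def)
qed

theorem proposition3p4:
  fixes n m :: nat and \<kappa> :: real and F G :: "real \<Rightarrow> complex"
  assumes "n < m" and "\<bar>\<kappa>\<bar> > 0"
    and "F \<in> I2 n m \<kappa>" and "G \<in> I2 n (n + 1) \<kappa>"
  shows "\<exists>C. \<forall>t. F t =
    of_real t ^ (n + 1) * exp (\<i> * of_real (\<kappa> * t)) *
      (\<Sum>j = n + 2..m. c_coeff n m (m - j) / (of_nat n - of_nat j + 1) *
          (bessel_J_scaled (int j) \<kappa> t + \<i> * bessel_J_scaled (int j - 1) \<kappa> t))
    + c_coeff n m (m - n - 1) * G t + C"
proof -
  let ?u = "\<lambda>p t. of_real t ^ (n + 1) * exp (\<i> * of_real (\<kappa> * t)) *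
        (bessel_J_scaled (int (Suc p)) \<kappa> t + \<i> * bessel_J_scaled (int p) \<kappa> t)"
  let ?c = "\<lambda>j. c_coeff n m (m - j)"
  define S where "S t = (\<Sum>p = n + 1..<m. ?c (Suc p) / (of_nat n - of_nat p) * ?u p t)" for t
  define T where "T t = of_real t ^ (n + 1) * exp (\<i> * of_real (\<kappa> * t)) *
      (\<Sum>j = n + 2..m. c_coeff n m (m - j) / (of_nat n - of_nat j + 1) *
          (bessel_J_scaled (int j) \<kappa> t + \<i> * bessel_J_scaled (int j - 1) \<kappa> t))" for t
  \<comment> \<open>Shifting the index to \<open>p = j - 1\<close> makes both Bessel orders natural numbers.\<close>
  have TS: "T t = S t" for t
  proof -
    have "{n + 2..m} = {Suc (n + 1)..<Suc m}"
      by auto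
    then show ?thesis
      unfolding T_def S_def sum_distrib_left
      by (simp only: sum.shift_bounds_Suc_ivl) (rule sum.cong, simp_all)
  qed
  have "(S has_vector_derivative I2_integrand n \<kappa> t m - ?c (n + 1) * I2_integrand n \<kappa> t (n + 1)) (at t)"
    for t
  proof -
    let ?I = "I2_integrand n \<kappa> t"
    have "(S has_vector_derivative (\<Sum>p = n + 1..<m. ?c (Suc p) / (of_nat n - of_nat p) *
        ((of_nat n - of_nat p) * ?I (Suc p) + \<i> * (of_nat n + of_nat (Suc p)) * ?I p))) (at t)"
      unfolding S_def
      by (intro has_vector_derivative_sum has_vector_derivative_mult_right bessel_exp_by_parts)
    also have "(\<Sum>p = n + 1..<m. ?c (Suc p) / (of_nat n - of_nat p) *
        ((of_nat n - of_nat p) * ?I (Suc p) + \<i> * (of_nat n + of_nat (Suc p)) * ?I p))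
      = (\<Sum>p = n + 1..<m. ?c (Suc p) * ?I (Suc p) - ?c p * ?I p)"
    proof (rule sum.cong)
      fix p assume p: "p \<in> {n + 1..<m}"
      then have d: "(of_nat n - of_nat p :: complex) \<noteq> 0"
        by auto
      have "p < m"
        using p by simp
      have alg: "x / d * (d * a + \<i> * s * b) = x * a - - \<i> * s / d * x * b"
        if "d \<noteq> 0" for x d a b s :: complex
        using that by (simp add: field_simps)
      show "?c (Suc p) / (of_nat n - of_nat p) *
        ((of_nat n - of_nat p) * ?I (Suc p) + \<i> * (of_nat n + of_nat (Suc p)) * ?I p)
        = ?c (Suc p) * ?I (Suc p) - ?c p * ?I p"
        unfolding c_coeff_descend[OF \<open>p < m\<close>] by (rule alg[OF d])
    qed simp
    also have "\<dots> = ?I m - ?c (n + 1) * ?I (n + 1)"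
      using assms(1) by (subst sum_Suc_diff') (simp_all add: c_coeff_0)
    finally show ?thesis .
  qed
  moreover have "(F has_vector_derivative I2_integrand n \<kappa> t m) (at t)"
    and "(G has_vector_derivative I2_integrand n \<kappa> t (n + 1)) (at t)" for t
    using assms(3,4) unfolding I2_def I2_integrand_def by blast+
  ultimately have "((\<lambda>t. F t - (S t + ?c (n + 1) * G t)) has_vector_derivative
      I2_integrand n \<kappa> t m - (I2_integrand n \<kappa> t m - ?c (n + 1) * I2_integrand n \<kappa> t (n + 1)
        + ?c (n + 1) * I2_integrand n \<kappa> t (n + 1))) (at t)" for t
    by (intro has_vector_derivative_diff has_vector_derivative_add has_vector_derivative_mult_right)
  then have "((\<lambda>t. F t - (S t + ?c (n + 1) * G t)) has_vector_derivative 0) (at t)" for t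
    by simp
  then obtain C where "\<And>t. F t - (S t + ?c (n + 1) * G t) = C"
    using has_vector_derivative_zero_constant[of UNIV "\<lambda>t. F t - (S t + ?c (n + 1) * G t)"]
    by auto
  then have "F t = S t + ?c (n + 1) * G t + C" for t
    by (metis add.commute diff_add_cancel)
  then have "F t = T t + c_coeff n m (m - n - 1) * G t + C" for t
    by (simp add: TS)
  then show ?thesis
    unfolding T_def by blast
qed

end
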